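(* Let $G$ be a graph on $n$ vertices with degree sequence $d_1\ge d_2\ge\cdots\ge d_n$ and let $m=\max\{i:d_i\ge i-1\}$. Then $G$ is an NG-3 graph if and only if (i) $\sum_{i=1}^{m+2} d_i=(m+2)(m+1)-10+\sum_{i=m+3}^n d_i$, and (ii) for every index $i$, $d_i=m-1$ if and only if $m-2\le i\le m+2$.
   Context: Graphs are finite and simple; $\chi$ is chromatic number and $\overline{G}$ the complement. A graph $G$ is an NG-graph if $\chi(G)+\chi(\overline{G})=|V(G)|+1$. The ABC-partition of $V(G)$ is $A=\{v:\deg(v)=\chi(G)-1\}$, $B=\{v:\deg(v)>\chi(G)-1\}$, $C=\{v:\deg(v)<\chi(G)-1\}$. An NG-3 graph is an NG-graph in which $G[A]$ induces a 5-cycle. *)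

theory Defs
  imports Main
begin

definition simple_graph :: "'a set \<Rightarrow> 'a set set \<Rightarrow> bool" where
  "simple_graph V E \<longleftrightarrow> finite V \<and> (\<forall>e\<in>E. e \<subseteq> V \<and> card e = 2)"

definition degree :: "'a set set \<Rightarrow> 'a \<Rightarrow> nat" where
  "degree E v = card {e \<in> E. v \<in> e}"

definition complement_edges :: "'a set \<Rightarrow> 'a set set \<Rightarrow> 'a set set" where
  "complement_edges V E = {e. e \<subseteq> V \<and> card e = 2 \<and> e \<notin> E}"

definition induced_edges :: "'a set set \<Rightarrow> 'a set \<Rightarrow> 'a set set" where
  "induced_edges E S = {e \<in> E. e \<subseteq> S}"

definition proper_coloring :: "'a set \<Rightarrow> 'a set set \<Rightarrow> nat \<Rightarrow> ('a \<Rightarrow> nat) \<Rightarrow> bool" where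
  "proper_coloring V E k c \<longleftrightarrow>
     (\<forall>v\<in>V. c v < k) \<and> (\<forall>u v. {u, v} \<in> E \<and> u \<noteq> v \<longrightarrow> c u \<noteq> c v)"

definition chromatic_number :: "'a set \<Rightarrow> 'a set set \<Rightarrow> nat" where
  "chromatic_number V E = (LEAST k. \<exists>c. proper_coloring V E k c)"

definition NG_graph :: "'a set \<Rightarrow> 'a set set \<Rightarrow> bool" where
  "NG_graph V E \<longleftrightarrow>
     chromatic_number V E + chromatic_number V (complement_edges V E) = card V + 1"

(* The part A of the ABC-partition.  A nonempty graph has positive chromatic number,
   so the natural-number subtraction does not truncate when V is nonempty. *)
definition ABC_A :: "'a set \<Rightarrow> 'a set set \<Rightarrow> 'a set" where
  "ABC_A V E = {v \<in> V. degree E v = chromatic_number V E - 1}"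

definition cycle_graph :: "nat \<Rightarrow> 'a set \<Rightarrow> 'a set set \<Rightarrow> bool" where
  "cycle_graph k V E \<longleftrightarrow> 3 \<le> k \<and>
     (\<exists>v. bij_betw v {..<k} V \<and> E = {{v i, v (Suc i mod k)} | i. i < k})"

definition NG3_graph :: "'a set \<Rightarrow> 'a set set \<Rightarrow> bool" where
  "NG3_graph V E \<longleftrightarrow>
     NG_graph V E \<and> cycle_graph 5 (ABC_A V E) (induced_edges E (ABC_A V E))"

(* d 1 \<ge> ... \<ge> d n, where n = card V, lists the vertex degrees; values of d at
   other arguments are irrelevant. *)
definition degree_sequence :: "'a set \<Rightarrow> 'a set set \<Rightarrow> (nat \<Rightarrow> nat) \<Rightarrow> bool" where
  "degree_sequence V E d \<longleftrightarrow>
     (\<exists>v. bij_betw v {1..card V} V \<and> (\<forall>i\<in>{1..card V}. d i = degree E (v i))) \<and>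
     (\<forall>i j. 1 \<le> i \<and> i \<le> j \<and> j \<le> card V \<longrightarrow> d j \<le> d i)"

end

(* NG-3 graphs are the graphs whose vertex set splits into a 5-cycle A, a clique B completely
   joined to A, and a stable set C without edges to A.  If A induces a 5-cycle, then vertices of C
   have too small a degree to matter for the chromatic number of G, so colouring A with three
   colours and B injectively gives chi(G) <= |B| + 3; dually the complement needs at most |C| + 3
   colours.  The NG condition forces equality in both, and any missing edge in B or between A and B
   would save a colour.  Conversely, with K the first m + 2 vertices, the sum condition says that
   the non-edges inside K and the edges inside C number 5 altogether, while the five vertices of
   degree m - 1 already account for all five; this again pins down the split. *)

theory Submission
  imports Defs
begin

section \<open>Edges, degrees and complements of simple graphs\<close>

lemma simple_graphD:
  assumes "simple_graph V E" "{u, v} \<in> E"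
  shows "u \<in> V" "v \<in> V" "u \<noteq> v"
  using assms unfolding simple_graph_def by (force simp: card_insert_if)+

lemma simple_graph_complement:
  "simple_graph V E \<Longrightarrow> simple_graph V (complement_edges V E)"
  by (auto simp: simple_graph_def complement_edges_def)

lemma complement_edge_iff:
  assumes "u \<in> V" "v \<in> V" "u \<noteq> v"
  shows "{u, v} \<in> complement_edges V E \<longleftrightarrow> {u, v} \<notin> E"
  using assms by (auto simp: complement_edges_def)

lemma degree_eq_card_neighbours:
  assumes "simple_graph V E"
  shows "degree E v = card {u \<in> V. {u, v} \<in> E}"
proof -
  have "{e \<in> E. v \<in> e} = (\<lambda>u. {u, v}) ` {u \<in> V. {u, v} \<in> E}"
  proof (intro equalityI subsetI)
    fix e assume e: "e \<in> {e \<in> E. v \<in> e}"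
    with assms have "e \<subseteq> V" "card e = 2" by (auto simp: simple_graph_def)
    then obtain x y where "e = {x, y}" "x \<in> V" "y \<in> V" by (auto simp: card_2_iff)
    with e show "e \<in> (\<lambda>u. {u, v}) ` {u \<in> V. {u, v} \<in> E}"
      by (auto simp: insert_commute)
  qed auto
  moreover have "inj_on (\<lambda>u. {u, v}) {u \<in> V. {u, v} \<in> E}"
    by (rule inj_onI) (auto simp: doubleton_eq_iff)
  ultimately show ?thesis unfolding degree_def by (simp add: card_image)
qed

text \<open>Indicator form over the integers, suited to splitting, subtracting and swapping sums in
  the later double counting.\<close>

lemma int_degree_eq_sum:
  assumes "simple_graph V E"
  shows "int (degree E v) = (\<Sum>u\<in>V. of_bool ({u, v} \<in> E))"
  using assms by (simp add: degree_eq_card_neighbours simple_graph_def sum_of_bool_eq Int_def)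

lemma degree_complement:
  assumes "simple_graph V E" "v \<in> V"
  shows "degree (complement_edges V E) v + degree E v + 1 = card V"
proof -
  let ?N = "{u \<in> V. {u, v} \<in> E}" and ?M = "{u \<in> V. {u, v} \<in> complement_edges V E}"
  have fin: "finite V" using assms by (simp add: simple_graph_def)
  have "{v} \<union> (?M \<union> ?N) = V"
    using assms(2) complement_edge_iff[of _ V v E] by auto
  moreover have "{v} \<inter> (?M \<union> ?N) = {}"
    using simple_graphD(3)[OF assms(1), of v v]
      simple_graphD(3)[OF simple_graph_complement[OF assms(1)], of v v] by auto
  moreover have "?M \<inter> ?N = {}" by (auto simp: complement_edges_def)
  ultimately have "card V = 1 + (card ?M + card ?N)"
    using fin card_Un_disjoint[of "{v}" "?M \<union> ?N"] card_Un_disjoint[of ?M ?N] by auto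
  then show ?thesis
    by (simp add: degree_eq_card_neighbours[OF assms(1)]
        degree_eq_card_neighbours[OF simple_graph_complement[OF assms(1)]])
qed

section \<open>Colourings and the chromatic number\<close>

text \<open>Vertices outside \<open>W\<close> have degree below \<open>j\<close>, so a colouring of \<open>W\<close> extends greedily.\<close>

lemma chromatic_number_le_card_image:
  assumes G: "simple_graph V E" and "W \<subseteq> V"
    and c: "\<And>u v. u \<in> W \<Longrightarrow> v \<in> W \<Longrightarrow> {u, v} \<in> E \<Longrightarrow> c u \<noteq> c v"
    and j: "card (c ` W) \<le> j"
    and deg: "\<And>v. v \<in> V - W \<Longrightarrow> degree E v < j"
  shows "chromatic_number V E \<le> j"
proof -
  have finV: "finite V" using G by (simp add: simple_graph_def)
  have "\<exists>c'. (\<forall>v\<in>W \<union> U. c' v < j) \<and> (\<forall>u\<in>W \<union> U. \<forall>v\<in>W \<union> U. {u, v} \<in> E \<longrightarrow> c' u \<noteq> (c' v :: nat))"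
    if "finite U" "U \<subseteq> V - W" for U
    using that
  proof (induction U rule: finite_induct)
    case empty
    have "finite (c ` W)" using finV \<open>W \<subseteq> V\<close> finite_subset by blast
    then obtain h where h: "bij_betw h (c ` W) {0..<card (c ` W)}"
      using ex_bij_betw_finite_nat by blast
    then have "h ` c ` W = {0..<card (c ` W)}" by (simp add: bij_betw_def)
    then have "\<forall>v\<in>W. h (c v) < j" using j by (metis atLeastLessThan_iff image_eqI less_le_trans)
    moreover have "\<forall>u\<in>W. \<forall>v\<in>W. {u, v} \<in> E \<longrightarrow> h (c u) \<noteq> h (c v)"
      using h c by (meson bij_betw_def image_eqI inj_on_eq_iff)
    ultimately show ?case by (intro exI[of _ "h \<circ> c"]) auto
  next
    case (insert x U)
    then obtain c' :: "'a \<Rightarrow> nat" where c': "\<forall>v\<in>W \<union> U. c' v < j"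
      "\<forall>u\<in>W \<union> U. \<forall>v\<in>W \<union> U. {u, v} \<in> E \<longrightarrow> c' u \<noteq> c' v" by auto
    \<comment> \<open>\<open>?N\<close> also contains neighbours not yet coloured, whose values
      under \<open>c'\<close> are arbitrary. Avoiding those values as well is harmless, since
      \<open>deg\<close> bounds the number of all neighbours.\<close>
    let ?N = "{u \<in> V. {u, x} \<in> E}"
    have "card (c' ` ?N) \<le> card ?N" using finV by (intro card_image_le) auto
    also have "\<dots> < j" using deg[of x] insert.prems degree_eq_card_neighbours[OF G, of x] by auto
    finally have "\<not> {..<j} \<subseteq> c' ` ?N"
      using finV card_mono[of "c' ` ?N" "{..<j}"] by fastforce
    then obtain k where k: "k < j" "k \<notin> c' ` ?N" by auto
    have nx: "u \<noteq> x" "c' u \<noteq> k" if "{u, x} \<in> E \<or> {x, u} \<in> E" for u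
      using that k simple_graphD[OF G, of u x] by (auto simp: insert_commute)
    show ?case
      using c' k nx by (intro exI[of _ "c'(x := k)"]) (auto; metis)
  qed
  from this[of "V - W"] finV obtain c' :: "'a \<Rightarrow> nat" where c': "\<forall>v\<in>W \<union> (V - W). c' v < j"
    "\<forall>u\<in>W \<union> (V - W). \<forall>v\<in>W \<union> (V - W). {u, v} \<in> E \<longrightarrow> c' u \<noteq> c' v" by auto
  then have "proper_coloring V E j c'"
    unfolding proper_coloring_def using simple_graphD[OF G] by blast
  then show ?thesis unfolding chromatic_number_def by (blast intro: Least_le)
qed

text \<open>An injective numbering of the vertices is a proper colouring, so the minimum in the
  definition is attained.\<close>

lemma proper_coloring_chromatic_number:
  assumes G: "simple_graph V E"
  obtains c where "proper_coloring V E (chromatic_number V E) c"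
proof -
  have "finite V" using G by (simp add: simple_graph_def)
  then obtain h where "bij_betw h V {0..<card V}" using ex_bij_betw_finite_nat by blast
  then have "proper_coloring V E (card V) h"
    using simple_graphD[OF G] unfolding proper_coloring_def bij_betw_def
    by (metis atLeastLessThan_iff image_eqI inj_on_eq_iff)
  then have "\<exists>k c. proper_coloring V E k c" by blast
  from LeastI_ex[OF this] that show ?thesis unfolding chromatic_number_def by blast
qed

section \<open>Induced 5-cycles\<close>

text \<open>The induced 5-cycle in the cyclic order \<open>a b c d e\<close>. All five edges and all
  five chords are written out, so that case distinctions over named vertices can be
  automated.\<close>

definition pentagon :: "'a set set \<Rightarrow> 'a \<Rightarrow> 'a \<Rightarrow> 'a \<Rightarrow> 'a \<Rightarrow> 'a \<Rightarrow> bool" where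
  "pentagon E a b c d e \<longleftrightarrow> distinct [a, b, c, d, e] \<and>
     {a, b} \<in> E \<and> {b, c} \<in> E \<and> {c, d} \<in> E \<and> {d, e} \<in> E \<and> {e, a} \<in> E \<and>
     {a, c} \<notin> E \<and> {b, d} \<notin> E \<and> {c, e} \<notin> E \<and> {d, a} \<notin> E \<and> {e, b} \<notin> E"

lemma pentagon_rotate: "pentagon E a b c d e \<Longrightarrow> pentagon E b c d e a"
  unfolding pentagon_def by (simp add: insert_commute eq_commute)

text \<open>Rotational symmetry: any chosen vertex may be taken as the first one.\<close>

lemma pentagon_rotate_to:
  assumes P: "pentagon E a b c d e" and "u \<in> {a, b, c, d, e}"
  obtains p q r s where "{a, b, c, d, e} = {u, p, q, r, s}" "pentagon E u p q r s"
proof -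
  note R = pentagon_rotate
  from assms(2) consider "u = a" | "u = b" | "u = c" | "u = d" | "u = e" by blast
  then show ?thesis
  proof cases
    case 1 show ?thesis using that[of b c d e] P 1 by auto
  next
    case 2 show ?thesis using that[of c d e a] R[OF P] 2 by auto
  next
    case 3 show ?thesis using that[of d e a b] R[OF R[OF P]] 3 by auto
  next
    case 4 show ?thesis using that[of e a b c] R[OF R[OF R[OF P]]] 4 by auto
  next
    case 5 show ?thesis using that[of a b c d] R[OF R[OF R[OF R[OF P]]]] 5 by auto
  qed
qed

text \<open>The 5-cycle is self-complementary: taking every second vertex traverses its five
  chords.\<close>

lemma pentagon_complement:
  assumes "pentagon E a b c d e" "{a, b, c, d, e} \<subseteq> V"
  shows "pentagon (complement_edges V E) a c e b d"
  using assms unfolding pentagon_def by (simp add: complement_edge_iff insert_commute eq_commute)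

lemma ex_pentagon_complement:
  assumes "\<exists>a b c d e. A = {a, b, c, d, e} \<and> pentagon E a b c d e" "A \<subseteq> V"
  shows "\<exists>a b c d e. A = {a, b, c, d, e} \<and> pentagon (complement_edges V E) a b c d e"
proof -
  obtain a b c d e where A: "A = {a, b, c, d, e}" and "pentagon E a b c d e" using assms(1) by blast
  then have "pentagon (complement_edges V E) a c e b d" using assms(2) by (intro pentagon_complement) simp_all
  moreover have "A = {a, c, e, b, d}" using A by auto
  ultimately show ?thesis by blast
qed

lemma lessThan_5: "{..<5::nat} = {0, 1, 2, 3, 4}" by auto

lemma five_cycle_edges:
  "{{v i, v (Suc i mod 5)} | i. i < 5} = {{v 0, v 1}, {v 1, v 2}, {v 2, v 3}, {v 3, v 4}, {v 4, v 0}}"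
proof -
  have succ: "Suc 0 mod 5 = 1" "Suc 1 mod 5 = 2" "Suc 2 mod 5 = 3" "Suc 3 mod 5 = 4" "Suc 4 mod 5 = 0"
    by code_simp+
  have "{{v i, v (Suc i mod 5)} | i. i < 5} = (\<lambda>i. {v i, v (Suc i mod 5)}) ` {..<5}" by auto
  then show ?thesis by (simp only: lessThan_5 image_insert image_empty succ)
qed

lemma cycle_graph_5_iff_pentagon:
  assumes G: "simple_graph V E"
  shows "cycle_graph 5 A (induced_edges E A) \<longleftrightarrow>
    (\<exists>a b c d e. A = {a, b, c, d, e} \<and> pentagon E a b c d e)"
proof
  assume "cycle_graph 5 A (induced_edges E A)"
  then obtain v where v: "bij_betw v {..<5} A"
    and ind: "induced_edges E A = {{v i, v (Suc i mod 5)} | i. i < 5}"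
    unfolding cycle_graph_def by blast
  have A: "A = {v 0, v 1, v 2, v 3, v 4}" using v by (auto simp: bij_betw_def lessThan_5)
  have dist: "distinct [v 0, v 1, v 2, v 3, v 4]"
    using v unfolding bij_betw_def lessThan_5 inj_on_def by simp
  have ind5: "induced_edges E A = {{v 0, v 1}, {v 1, v 2}, {v 2, v 3}, {v 3, v 4}, {v 4, v 0}}"
    unfolding ind by (rule five_cycle_edges)
  have E: "{x, y} \<in> E \<longleftrightarrow>
      {x, y} \<in> {{v 0, v 1}, {v 1, v 2}, {v 2, v 3}, {v 3, v 4}, {v 4, v 0}}" if "x \<in> A" "y \<in> A" for x y
  proof -
    have "{x, y} \<in> E \<longleftrightarrow> {x, y} \<in> induced_edges E A" using that by (simp add: induced_edges_def)
    then show ?thesis by (simp only: ind5)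
  qed
  have "pentagon E (v 0) (v 1) (v 2) (v 3) (v 4)"
    using dist unfolding pentagon_def by (auto simp: E A doubleton_eq_iff)
  with A show "\<exists>a b c d e. A = {a, b, c, d, e} \<and> pentagon E a b c d e" by blast
next
  assume "\<exists>a b c d e. A = {a, b, c, d, e} \<and> pentagon E a b c d e"
  then obtain a b c d e where A: "A = {a, b, c, d, e}" and P: "pentagon E a b c d e" by blast
  define v where "v = (\<lambda>i. [a, b, c, d, e] ! i)"
  have v: "v 0 = a" "v 1 = b" "v 2 = c" "v 3 = d" "v 4 = e"
    by (simp_all add: v_def eval_nat_numeral)
  have "bij_betw v {..<5} A"
    unfolding v_def by (rule bij_betw_nth) (use P A in \<open>auto simp: pentagon_def\<close>)
  moreover have "induced_edges E A = {{v i, v (Suc i mod 5)} | i. i < 5}"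
  proof -
    have "{{v i, v (Suc i mod 5)} | i. i < 5} = {{a, b}, {b, c}, {c, d}, {d, e}, {e, a}}"
      unfolding five_cycle_edges v ..
    also have "\<dots> = induced_edges E A"
    proof (intro equalityI subsetI)
      fix f assume f: "f \<in> induced_edges E A"
      then have "card f = 2" "f \<subseteq> A" "f \<in> E" using G by (auto simp: induced_edges_def simple_graph_def)
      then obtain x y where "f = {x, y}" "x \<in> A" "y \<in> A" "x \<noteq> y" by (auto simp: card_2_iff)
      moreover have "{a, c} \<notin> E" "{b, d} \<notin> E" "{c, e} \<notin> E" "{d, a} \<notin> E" "{e, b} \<notin> E"
        "{c, a} \<notin> E" "{d, b} \<notin> E" "{e, c} \<notin> E" "{a, d} \<notin> E" "{b, e} \<notin> E"
        using P unfolding pentagon_def by (simp_all add: insert_commute)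
      ultimately show "f \<in> {{a, b}, {b, c}, {c, d}, {d, e}, {e, a}}"
        using \<open>f \<in> E\<close> unfolding A by (elim insertE emptyE; simp add: doubleton_eq_iff)
    qed (use P in \<open>auto simp: A pentagon_def induced_edges_def\<close>)
    finally show ?thesis by simp
  qed
  ultimately show "cycle_graph 5 A (induced_edges E A)" unfolding cycle_graph_def by auto
qed

text \<open>Starting at \<open>a\<close>, the cycle is followed in both directions. Closing up after
  three or four vertices would leave at most two vertices, too few to give each other two
  neighbours.\<close>

lemma pentagon_of_two_regular:
  assumes G: "simple_graph V E" and cardA: "card A = 5"
    and reg: "\<And>v. v \<in> A \<Longrightarrow> card {u \<in> A. {u, v} \<in> E} = 2"
  shows "\<exists>a b c d e. A = {a, b, c, d, e} \<and> pentagon E a b c d e"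
proof -
  define N where "N = (\<lambda>v. {u \<in> A. {u, v} \<in> E})"
  have finA: "finite A" using cardA by (simp add: card_ge_0_finite)
  have sub: "u \<in> A" if "u \<in> N v" for u v using that by (simp add: N_def)
  have sym: "v \<in> N u" if "v \<in> A" "u \<in> N v" for u v
    using that by (simp add: N_def insert_commute)
  have irr: "v \<notin> N v" for v using simple_graphD(3)[OF G, of v v] by (auto simp: N_def)
  have cardN: "card (N v) = 2" if "v \<in> A" for v using reg[OF that] by (simp add: N_def)
  have other: "\<exists>y. N v = {x, y} \<and> y \<noteq> x \<and> y \<in> A \<and> y \<noteq> v" if v: "v \<in> A" and x: "x \<in> N v" for x v
  proof -
    obtain p q where pq: "N v = {p, q}" "p \<noteq> q" using cardN[OF v] by (meson card_2_iff)
    then have "p \<in> A" "q \<in> A" "p \<noteq> v" "q \<noteq> v" using sub[of _ v] irr[of v] by auto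
    with pq x show ?thesis by (metis doubleton_eq_iff insertE singletonD)
  qed
  have big: "\<exists>x\<in>A. x \<notin> set xs" if "length xs < 5" for xs
  proof (rule ccontr)
    assume "\<not> ?thesis"
    then have "card A \<le> card (set xs)" by (intro card_mono) auto
    with that cardA card_length[of xs] show False by simp
  qed
  have all: "A = {p, q, r, s, t}"
    if "distinct [p, q, r, s, t]" "p \<in> A" "q \<in> A" "r \<in> A" "s \<in> A" "t \<in> A" for p q r s t
  proof (rule card_seteq[OF finA, symmetric])
    show "card A \<le> card {p, q, r, s, t}" using that(1) cardA by simp
  qed (use that in simp)
  obtain a where a: "a \<in> A" using cardA by (metis all_not_in_conv card.empty zero_neq_numeral)
  obtain b e where Na: "N a = {b, e}" "b \<noteq> e" using cardN[OF a] by (meson card_2_iff)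
  have be: "b \<in> A" "e \<in> A" "b \<noteq> a" "e \<noteq> a" using sub[of _ a] irr[of a] Na by auto
  have "a \<in> N b" "a \<in> N e" using sym[OF a] Na by simp_all
  then obtain c d where c: "N b = {a, c}" "c \<noteq> a" "c \<in> A" "c \<noteq> b"
    and d: "N e = {a, d}" "d \<noteq> a" "d \<in> A" "d \<noteq> e"
    using other[OF be(1)] other[OF be(2)] by metis
  have bc: "b \<in> N c" and ed: "e \<in> N d" using sym[OF be(1)] sym[OF be(2)] c(1) d(1) by simp_all
  \<comment> \<open>Otherwise \<open>a b e\<close> is a triangle with no free neighbour slot, and
    \<open>x\<close> can only be adjacent to \<open>y\<close>.\<close>
  have "c \<noteq> e"
  proof
    assume "c = e"
    then have Ne: "N e = {a, b}" using bc d(1) be by auto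
    obtain x where x: "x \<in> A" "x \<notin> set [a, b, e]" using big[of "[a, b, e]"] by auto
    obtain y where y: "y \<in> A" "y \<notin> set [a, b, e, x]" using big[of "[a, b, e, x]"] by auto
    have "A = {a, b, e, x, y}" using x y a be Na(2) by (intro all) auto
    moreover have "x \<notin> N a" "x \<notin> N b" "x \<notin> N e" using Na(1) c(1) Ne \<open>c = e\<close> x by simp_all
    then have "a \<notin> N x" "b \<notin> N x" "e \<notin> N x" using sym[OF x(1)] by blast+
    ultimately have "N x \<subseteq> {y}" using irr[of x] sub[of _ x] by blast
    then have "card (N x) \<le> 1" using card_mono[of "{y}"] by fastforce
    with cardN[OF x(1)] show False by simp
  qed
  then have "d \<noteq> b" using ed c(1) be by auto
  \<comment> \<open>Otherwise \<open>a b c e\<close> is a closed 4-cycle and the fifth vertex has no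
    neighbour in \<open>A\<close>.\<close>
  have "d \<noteq> c"
  proof
    assume "d = c"
    then have Nc: "N c = {b, e}" using other[OF c(3) bc] ed Na(2) by auto
    obtain x where x: "x \<in> A" "x \<notin> set [a, b, e, c]" using big[of "[a, b, e, c]"] by auto
    have "A = {a, b, e, c, x}" using x a be c(2-4) Na(2) \<open>c \<noteq> e\<close> by (intro all) auto
    moreover have "x \<notin> N a" "x \<notin> N b" "x \<notin> N e" "x \<notin> N c"
      using Na(1) c(1) d(1) Nc \<open>d = c\<close> x by simp_all
    then have "a \<notin> N x" "b \<notin> N x" "e \<notin> N x" "c \<notin> N x" using sym[OF x(1)] by blast+
    ultimately have "N x = {}" using irr[of x] sub[of _ x] by blast
    with cardN[OF x(1)] show False by simp
  qed
  have dist: "distinct [a, b, c, d, e]"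
    using Na(2) be c(2-4) d(2-4) \<open>c \<noteq> e\<close> \<open>d \<noteq> b\<close> \<open>d \<noteq> c\<close> by auto
  then have A: "A = {a, b, c, d, e}" using a be c(3) d(3) by (intro all)
  \<comment> \<open>The second neighbour of \<open>c\<close> must be \<open>d\<close>, because
    \<open>a\<close> and \<open>e\<close> already have two neighbours other than
    \<open>c\<close>.\<close>
  obtain y where y: "N c = {b, y}" "y \<noteq> b" "y \<in> A" "y \<noteq> c" using other[OF c(3) bc] by blast
  have "c \<in> N y" using sym[OF c(3)] y(1) by simp
  then have "y \<noteq> a" "y \<noteq> e" using Na(1) d(1) dist by auto
  then have "y = d" using y(2-4) A by simp
  then have in_N: "b \<in> N a" "c \<in> N b" "d \<in> N c" "d \<in> N e" "e \<in> N a"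
    and notin_N: "c \<notin> N a" "d \<notin> N b" "e \<notin> N c" "d \<notin> N a" "e \<notin> N b"
    using Na(1) c(1) d(1) y(1) dist by auto
  have "{a, b} \<in> E" "{b, c} \<in> E" "{c, d} \<in> E" "{d, e} \<in> E" "{e, a} \<in> E"
    using in_N by (simp_all add: N_def insert_commute)
  moreover have "{a, c} \<notin> E" "{b, d} \<notin> E" "{c, e} \<notin> E" "{d, a} \<notin> E" "{e, b} \<notin> E"
    using notin_N a be c(3) d(3) by (simp_all add: N_def insert_commute)
  ultimately show ?thesis using A dist unfolding pentagon_def by blast
qed

section \<open>Colouring bounds from a pentagon and low-degree vertices\<close>

text \<open>If \<open>A \<union> B\<close> could be coloured with fewer than chi colours, the low
  degrees in \<open>C\<close> would let the colouring extend to \<open>V\<close> with chi - 1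
  colours. So every colouring of \<open>A \<union> B\<close> bounds chi, and each claim only needs a
  suitable one. The same lemma later serves the complement with \<open>B\<close> and
  \<open>C\<close> exchanged.\<close>

lemma chromatic_number_pentagon_join:
  assumes G: "simple_graph V E" and V: "V = A \<union> B \<union> C"
    and disj: "A \<inter> B = {}"
    and pent: "\<exists>a b c d e. A = {a, b, c, d, e} \<and> pentagon E a b c d e"
    and deg: "\<And>v. v \<in> C \<Longrightarrow> degree E v < chromatic_number V E - 1"
  shows "chromatic_number V E \<le> card B + 3"
    and "chromatic_number V E = card B + 3 \<Longrightarrow> u \<in> A \<Longrightarrow> v \<in> B \<Longrightarrow> {u, v} \<in> E"
    and "chromatic_number V E = card B + 3 \<Longrightarrow> u \<in> B \<Longrightarrow> v \<in> B \<Longrightarrow> u \<noteq> v \<Longrightarrow> {u, v} \<in> E"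
proof -
  have finB: "finite B" using G V by (simp add: simple_graph_def)
  have bound: "chromatic_number V E \<le> card (f ` (A \<union> B))"
    if "\<And>u v. u \<in> A \<union> B \<Longrightarrow> v \<in> A \<union> B \<Longrightarrow> {u, v} \<in> E \<Longrightarrow> f u \<noteq> f v" for f :: "'a \<Rightarrow> 'a"
  proof (rule ccontr)
    assume less: "\<not> ?thesis"
    then have "chromatic_number V E \<le> chromatic_number V E - 1"
      using that V deg by (intro chromatic_number_le_card_image[OF G, of "A \<union> B" f]) auto
    with less show False by simp
  qed
  obtain a b c d e where A: "A = {a, b, c, d, e}" and P: "pentagon E a b c d e" using pent by blast
  have dB: "a \<notin> B" "b \<notin> B" "c \<notin> B" "d \<notin> B" "e \<notin> B" using disj A by auto
  \<comment> \<open>Colours are vertices: identifying \<open>c\<close> with \<open>a\<close> and \<open>d\<close> with \<open>b\<close> 3-colours the pentagon.\<close>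
  define f where "f = (\<lambda>x. if x = c then a else if x = d then b else x)"
  have fA: "f u \<noteq> f v" if "{u, v} \<in> E" for u v
  proof
    assume "f u = f v"
    then have "u = v \<or> {u, v} = {a, c} \<or> {u, v} = {b, d}"
      using P unfolding f_def pentagon_def by (auto split: if_splits)
    with that simple_graphD(3)[OF G that] P show False unfolding pentagon_def by metis
  qed
  have fim: "f ` (A \<union> B) = {a, b, e} \<union> B"
    using A P dB unfolding f_def pentagon_def by (auto simp: image_iff)
  have c3: "card ({a, b, e} \<union> S) \<le> card S + 3" for S
    using card_Un_le[of "{a, b, e}" S] by (simp add: card_insert_if split: if_splits)
  show "chromatic_number V E \<le> card B + 3"
    using bound[of f, OF fA] fim c3[of B] by simp
  show "{u, v} \<in> E" if eq: "chromatic_number V E = card B + 3" and "u \<in> B" "v \<in> B" "u \<noteq> v"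
  proof (rule ccontr)
    assume nE: "{u, v} \<notin> E"
    \<comment> \<open>The vertex \<open>v\<close> takes over the colour of its non-neighbour
      \<open>u\<close>, so the colour \<open>v\<close> is saved.\<close>
    let ?g = "\<lambda>x. if x = v then u else f x"
    have "?g ` (A \<union> B) \<subseteq> {a, b, e} \<union> (B - {v})"
      using that fim dB unfolding f_def by auto
    then have "card (?g ` (A \<union> B)) \<le> card (B - {v}) + 3"
      using c3[of "B - {v}"] finB card_mono[of "{a, b, e} \<union> (B - {v})" "?g ` (A \<union> B)"] by simp
    moreover have "card B = Suc (card (B - {v}))" using card_Suc_Diff1[OF finB \<open>v \<in> B\<close>] by simp
    moreover have "chromatic_number V E \<le> card (?g ` (A \<union> B))"
    proof (rule bound)
      fix x y assume xy: "x \<in> A \<union> B" "y \<in> A \<union> B" "{x, y} \<in> E"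
      \<comment> \<open>No other vertex has colour \<open>u\<close>, since \<open>f\<close> moves
        vertices only to \<open>a\<close> and \<open>b\<close>, which lie outside
        \<open>B\<close>.\<close>
      have fu: "f z = u \<longleftrightarrow> z = u" for z using that dB unfolding f_def by auto
      show "?g x \<noteq> ?g y"
        using fA[OF xy(3)] xy nE simple_graphD(3)[OF G xy(3)] fu[of x] fu[of y] by (auto simp: insert_commute)
    qed
    ultimately show False using eq by simp
  qed
  show "{u, v} \<in> E" if eq: "chromatic_number V E = card B + 3" and "u \<in> A" "v \<in> B"
  proof (rule ccontr)
    assume nE: "{u, v} \<notin> E"
    obtain p q r s where A': "A = {u, p, q, r, s}" and P': "pentagon E u p q r s"
      using pentagon_rotate_to[OF P, of u] \<open>u \<in> A\<close> A by metis
    have dB': "p \<notin> B" "q \<notin> B" "r \<notin> B" "s \<notin> B" "u \<notin> B" using disj A' by auto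
    \<comment> \<open>If \<open>u\<close> takes the colour of \<open>v\<close>, the remaining path needs only two further colours.\<close>
    let ?g = "\<lambda>x. if x = u then v else if x = r then p else if x = s then q else x"
    have "?g ` (A \<union> B) \<subseteq> {p, q} \<union> B" using A' \<open>v \<in> B\<close> by auto
    then have "card (?g ` (A \<union> B)) \<le> card ({p, q} \<union> B)"
      using finB by (intro card_mono) auto
    also have "\<dots> \<le> card B + 2"
      using card_Un_le[of "{p, q}" B] by (simp add: card_insert_if split: if_splits)
    finally have "card (?g ` (A \<union> B)) \<le> card B + 2" .
    moreover have "chromatic_number V E \<le> card (?g ` (A \<union> B))"
    proof (rule bound)
      fix x y assume xy: "x \<in> A \<union> B" "y \<in> A \<union> B" "{x, y} \<in> E"
      show "?g x \<noteq> ?g y"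
      proof
        assume "?g x = ?g y"
        then have "x = y \<or> {x, y} = {u, v} \<or> {x, y} = {p, r} \<or> {x, y} = {q, s}"
          using P' dB' \<open>v \<in> B\<close> unfolding pentagon_def by (auto split: if_splits)
        with xy(3) simple_graphD(3)[OF G xy(3)] P' nE show False unfolding pentagon_def by metis
      qed
    qed
    ultimately show False using eq by simp
  qed
qed

section \<open>Graphs split into a pentagon, a clique and a stable set\<close>

text \<open>The structural form of NG-3 graphs; edges between \<open>B\<close> and \<open>C\<close>
  are unrestricted. The assumptions are symmetric under complementation with \<open>B\<close> and
  \<open>C\<close> exchanged, so each consequence also holds for the complement.\<close>

locale pentagon_split =
  fixes V :: "'a set" and E :: "'a set set" and A B C :: "'a set"
  assumes graph: "simple_graph V E"
    and V_eq: "V = A \<union> B \<union> C"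
    and disjoint: "A \<inter> B = {}" "A \<inter> C = {}" "B \<inter> C = {}"
    and pentagon_A: "\<exists>a b c d e. A = {a, b, c, d, e} \<and> pentagon E a b c d e"
    and AB: "\<And>u v. u \<in> A \<Longrightarrow> v \<in> B \<Longrightarrow> {u, v} \<in> E"
    and BB: "\<And>u v. u \<in> B \<Longrightarrow> v \<in> B \<Longrightarrow> u \<noteq> v \<Longrightarrow> {u, v} \<in> E"
    and AC: "\<And>u v. u \<in> A \<Longrightarrow> v \<in> C \<Longrightarrow> {u, v} \<notin> E"
    and CC: "\<And>u v. u \<in> C \<Longrightarrow> v \<in> C \<Longrightarrow> {u, v} \<notin> E"
begin

lemma finite_parts: "finite A" "finite B" "finite C"
  using graph V_eq by (auto simp: simple_graph_def)

lemma card_A: "card A = 5"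
  using pentagon_A unfolding pentagon_def by auto

lemma card_V: "card V = card B + 5 + card C"
  using V_eq disjoint finite_parts card_A by (simp add: card_Un_disjoint Int_Un_distrib2)

lemma complement: "pentagon_split V (complement_edges V E) A C B"
proof
  show "simple_graph V (complement_edges V E)" using graph by (rule simple_graph_complement)
  show "\<exists>a b c d e. A = {a, b, c, d, e} \<and> pentagon (complement_edges V E) a b c d e"
    using pentagon_A V_eq by (intro ex_pentagon_complement) auto
next
  fix u v assume uv: "u \<in> A" "v \<in> C"
  then have "u \<noteq> v" using disjoint by auto
  then show "{u, v} \<in> complement_edges V E" using AC[OF uv] uv V_eq by (simp add: complement_edge_iff)
next
  fix u v assume uv: "u \<in> C" "v \<in> C" "u \<noteq> v"
  then show "{u, v} \<in> complement_edges V E" using CC V_eq by (simp add: complement_edge_iff)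
next
  fix u v assume uv: "u \<in> B" "v \<in> B"
  then show "{u, v} \<notin> complement_edges V E"
    using BB[OF uv] by (cases "u = v") (auto simp: complement_edges_def)
qed (use V_eq disjoint AB in \<open>auto simp: complement_edges_def\<close>)

text \<open>The neighbours are the two on the cycle and all of \<open>B\<close>.\<close>

lemma degree_A: "v \<in> A \<Longrightarrow> degree E v = card B + 2"
proof -
  assume v: "v \<in> A"
  have two: "card {u \<in> A. {u, v} \<in> E} = 2"
  proof -
    obtain p q r s where A: "A = {v, p, q, r, s}" and P: "pentagon E v p q r s"
      using pentagon_A pentagon_rotate_to[of E _ _ _ _ _ v] v by metis
    then have "{u \<in> A. {u, v} \<in> E} = {p, s}"
      using simple_graphD(3)[OF graph, of v v] unfolding pentagon_def by (auto simp: insert_commute)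
    then show ?thesis using P unfolding pentagon_def by simp
  qed
  have "{u \<in> V. {u, v} \<in> E} = {u \<in> A. {u, v} \<in> E} \<union> B"
    using V_eq AB[OF v] AC[OF v] by (auto simp: insert_commute[of _ v])
  moreover have "card ({u \<in> A. {u, v} \<in> E} \<union> B) = 2 + card B"
    using two disjoint finite_parts by (subst card_Un_disjoint) auto
  ultimately show ?thesis using degree_eq_card_neighbours[OF graph, of v] by simp
qed

lemma degree_B:
  assumes v: "v \<in> B"
  shows "degree E v = card B + 4 + card {u \<in> C. {u, v} \<in> E}"
proof -
  have "{u \<in> V. {u, v} \<in> E} = (A \<union> (B - {v})) \<union> {u \<in> C. {u, v} \<in> E}"
    using v V_eq AB[of _ v] BB[of _ v] simple_graphD(3)[OF graph] by auto
  moreover have "card ((A \<union> (B - {v})) \<union> {u \<in> C. {u, v} \<in> E}) =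
      card A + card (B - {v}) + card {u \<in> C. {u, v} \<in> E}"
    using disjoint finite_parts by (subst card_Un_disjoint; (subst card_Un_disjoint)?) auto
  moreover have "card B = Suc (card (B - {v}))"
    using card_Suc_Diff1[OF finite_parts(2) v] by simp
  ultimately show ?thesis using degree_eq_card_neighbours[OF graph, of v] card_A by simp
qed

lemma degree_C:
  assumes v: "v \<in> C"
  shows "degree E v = card {u \<in> B. {u, v} \<in> E}"
proof -
  have "{u \<in> V. {u, v} \<in> E} = {u \<in> B. {u, v} \<in> E}" using v V_eq AC[of _ v] CC[of _ v] by auto
  then show ?thesis using degree_eq_card_neighbours[OF graph, of v] by simp
qed

text \<open>Together with \<open>degree_A\<close> and \<open>degree_B\<close> this separates the
  parts by degree: at most \<open>card B\<close> on \<open>C\<close>, exactly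
  \<open>card B + 2\<close> on \<open>A\<close>, at least \<open>card B + 4\<close> on
  \<open>B\<close>.\<close>

lemma degree_C_le: "v \<in> C \<Longrightarrow> degree E v \<le> card B"
  using finite_parts by (simp add: degree_C card_mono)

text \<open>The odd cycle \<open>A\<close> needs three colours, the clique \<open>B\<close> needs
  \<open>card B\<close>, and the join between them keeps the two colour sets disjoint.\<close>

lemma chromatic_number_eq: "chromatic_number V E = card B + 3"
proof (rule antisym)
  obtain a b c d e where A: "A = {a, b, c, d, e}" and P: "pentagon E a b c d e" using pentagon_A by blast
  obtain g where g: "proper_coloring V E (chromatic_number V E) g"
    using proper_coloring_chromatic_number[OF graph] .
  have ne: "g u \<noteq> g v" if "{u, v} \<in> E" for u v
    using g that simple_graphD(3)[OF graph that] unfolding proper_coloring_def by blast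
  have "card (g ` A) \<ge> 3"
  proof (rule ccontr)
    assume "\<not> card (g ` A) \<ge> 3"
    moreover have ab: "g a \<noteq> g b" "g b \<noteq> g c" "g c \<noteq> g d" "g d \<noteq> g e" "g e \<noteq> g a"
      using ne P unfolding pentagon_def by blast+
    moreover have "card {g a, g b} = 2" "{g a, g b} \<subseteq> g ` A" using ab A by auto
    ultimately have "{g a, g b} = g ` A" using finite_parts by (intro card_seteq) auto
    then have "g c \<in> {g a, g b}" "g d \<in> {g a, g b}" "g e \<in> {g a, g b}" using A by auto
    with ab show False by auto
  qed
  moreover have "card (g ` B) = card B"
    using BB ne by (intro card_image inj_onI) blast
  moreover have "g ` A \<inter> g ` B = {}" using AB ne by blast
  ultimately have "card B + 3 \<le> card (g ` (A \<union> B))"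
    using finite_parts by (simp add: image_Un card_Un_disjoint)
  also have "\<dots> \<le> card {..<chromatic_number V E}"
    using g V_eq unfolding proper_coloring_def by (intro card_mono) auto
  finally show lower: "card B + 3 \<le> chromatic_number V E" by simp
  \<comment> \<open>The lower bound turns the degree bound on \<open>C\<close> into the hypothesis
    of the colouring lemma, which then yields the upper bound.\<close>
  have "degree E v < chromatic_number V E - 1" if "v \<in> C" for v
    using degree_C_le[OF that] lower by linarith
  then show "chromatic_number V E \<le> card B + 3"
    by (rule chromatic_number_pentagon_join(1)[OF graph V_eq disjoint(1) pentagon_A])
qed

lemma ABC_A_eq: "ABC_A V E = A"
  using degree_A degree_B degree_C_le disjoint V_eq
  unfolding ABC_A_def chromatic_number_eq by fastforce

text \<open>With the complement's chromatic number \<open>card C + 3\<close>, the two numbers add up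
  to \<open>card B + card C + 6\<close>, which is \<open>card V + 1\<close>.\<close>

lemma NG3: "NG3_graph V E"
proof -
  interpret co: pentagon_split V "complement_edges V E" A C B by (rule complement)
  have "NG_graph V E"
    unfolding NG_graph_def chromatic_number_eq co.chromatic_number_eq card_V by simp
  then show ?thesis
    unfolding NG3_graph_def ABC_A_eq cycle_graph_5_iff_pentagon[OF graph] using pentagon_A by blast
qed

end

section \<open>From NG-3 graphs to the split\<close>

lemma NG3_imp_pentagon_split:
  assumes G: "simple_graph V E" and NG3: "NG3_graph V E"
  obtains A B C where "pentagon_split V E A B C"
proof -
  let ?k = "chromatic_number V E" and ?E' = "complement_edges V E"
  let ?l = "chromatic_number V ?E'"
  define A where "A = ABC_A V E"
  define B where "B = {v \<in> V. degree E v > ?k - 1}"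
  define C where "C = {v \<in> V. degree E v < ?k - 1}"
  note G' = simple_graph_complement[OF G]
  have finV: "finite V" using G by (simp add: simple_graph_def)
  have V: "V = A \<union> B \<union> C" "V = A \<union> C \<union> B" unfolding A_def B_def C_def ABC_A_def by auto
  have disj: "A \<inter> B = {}" "A \<inter> C = {}" "B \<inter> C = {}" unfolding A_def B_def C_def ABC_A_def by auto
  have pent: "\<exists>a b c d e. A = {a, b, c, d, e} \<and> pentagon E a b c d e"
    using NG3 cycle_graph_5_iff_pentagon[OF G] unfolding NG3_graph_def A_def by blast
  then have A5: "card A = 5" unfolding pentagon_def by auto
  have pent': "\<exists>a b c d e. A = {a, b, c, d, e} \<and> pentagon ?E' a b c d e"
    by (rule ex_pentagon_complement[OF pent]) (use V in blast)
  have kl: "?k + ?l = card V + 1" using NG3 unfolding NG3_graph_def NG_graph_def by blast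
  have cardV: "card V = 5 + card B + card C"
    using V(1) finV disj A5 by (simp add: card_Un_disjoint Int_Un_distrib2)
  have "?k > 0"
  proof -
    obtain g where "proper_coloring V E ?k g" using proper_coloring_chromatic_number[OF G] .
    moreover have "V \<noteq> {}" using cardV by auto
    ultimately show ?thesis unfolding proper_coloring_def by fastforce
  qed
  have degC: "degree E v < ?k - 1" if "v \<in> C" for v using that unfolding C_def by auto
  \<comment> \<open>By \<open>kl\<close>, \<open>?l - 1\<close> equals \<open>card V - ?k\<close>;
    complementing degrees thus turns the high-degree part \<open>B\<close> into the low-degree part
    of the complement.\<close>
  have degB: "degree ?E' v < ?l - 1" if "v \<in> B" for v
    using that degree_complement[OF G, of v] kl \<open>?k > 0\<close> unfolding B_def by auto
  note J = chromatic_number_pentagon_join[OF G V(1) disj(1) pent degC]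
  note J' = chromatic_number_pentagon_join[OF G' V(2) disj(2) pent' degB]
  \<comment> \<open>The two upper bounds sum to exactly the value of \<open>?k + ?l\<close>, so
    neither has slack.\<close>
  have k: "?k = card B + 3" and l: "?l = card C + 3"
    using J(1) J'(1) kl cardV by linarith+
  have "pentagon_split V E A B C"
  proof
    fix u v assume "u \<in> A" "v \<in> C"
    then show "{u, v} \<notin> E" using J'(2)[OF _ l] by (auto simp: complement_edges_def)
  next
    fix u v assume "u \<in> C" "v \<in> C"
    then show "{u, v} \<notin> E"
      using J'(3)[OF _ l] simple_graphD(3)[OF G, of u v] by (auto simp: complement_edges_def)
  qed (use G V disj pent J(2)[OF _ k] J(3)[OF _ k] in auto)
  then show ?thesis by (rule that)
qed

section \<open>From the degree sum to the split\<close>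

text \<open>Each vertex of \<open>A\<close> misses at least two others of \<open>A \<union> B\<close>, which exhausts the deficit of 10.\<close>

lemma pentagon_split_of_degrees:
  assumes G: "simple_graph V E" and V: "V = A \<union> B \<union> C"
    and disj: "A \<inter> B = {}" "A \<inter> C = {}" "B \<inter> C = {}"
    and A5: "card A = 5"
    and degA: "\<And>v. v \<in> A \<Longrightarrow> degree E v = card B + 2"
    and sum: "(\<Sum>v\<in>A \<union> B. int (degree E v)) =
      (int (card B) + 5) * (int (card B) + 4) - 10 + (\<Sum>v\<in>C. int (degree E v))"
  shows "pentagon_split V E A B C"
proof -
  define K where "K = A \<union> B"
  have fin: "finite A" "finite B" "finite C" "finite K"
    using G V unfolding K_def by (auto simp: simple_graph_def)
  have VK: "V = K \<union> C" "K \<inter> C = {}" using V disj unfolding K_def by auto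
  have cardK: "card K = card B + 5" unfolding K_def using fin disj A5 by (simp add: card_Un_disjoint)
  define w where "w = (\<lambda>u v. of_bool ({u, v} \<in> E) :: int)"
  define q where "q = (\<lambda>u v. of_bool (u \<noteq> v \<and> {u, v} \<notin> E) :: int)"
  have w_sym: "w u v = w v u" for u v by (simp add: w_def insert_commute)
  have nonneg: "w u v \<ge> 0" "q u v \<ge> 0" for u v by (simp_all add: w_def q_def)
  have deg: "int (degree E v) = (\<Sum>u\<in>K. w u v) + (\<Sum>u\<in>C. w u v)" for v
    unfolding int_degree_eq_sum[OF G] w_def VK(1) using VK(2) fin by (intro sum.union_disjoint)
  have row: "(\<Sum>u\<in>K. w u v) + (\<Sum>u\<in>K. q u v) = int (card B) + 4" if "v \<in> K" for v
  proof -
    have "(\<Sum>u\<in>K. w u v) + (\<Sum>u\<in>K. q u v) = (\<Sum>u\<in>K. of_bool (u \<noteq> v))"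
      unfolding sum.distrib[symmetric]
      using simple_graphD(3)[OF G] by (intro sum.cong) (auto simp: w_def q_def)
    also have "\<dots> = int (card (K - {v}))"
      using fin by (simp add: sum_of_bool_eq set_diff_eq Int_def)
    also have "\<dots> = int (card B) + 4" using that cardK by simp
    finally show ?thesis .
  qed
  \<comment> \<open>All four count ordered pairs: \<open>QA\<close> and \<open>QB\<close> the
    non-adjacent ones in \<open>K\<close> by their end in \<open>A\<close> or \<open>B\<close>,
    \<open>WA\<close> the edges between \<open>A\<close> and \<open>C\<close>, \<open>WC\<close>
    each edge inside \<open>C\<close> twice.\<close>
  define QA QB WA WC where "QA = (\<Sum>v\<in>A. \<Sum>u\<in>K. q u v)" and "QB = (\<Sum>v\<in>B. \<Sum>u\<in>K. q u v)"
    and "WA = (\<Sum>v\<in>A. \<Sum>u\<in>C. w u v)" and "WC = (\<Sum>v\<in>C. \<Sum>u\<in>C. w u v)"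
  have "(\<Sum>v\<in>K. int (degree E v)) =
      (\<Sum>v\<in>K. int (card B) + 4 - (\<Sum>u\<in>K. q u v) + (\<Sum>u\<in>C. w u v))"
    using row deg by (intro sum.cong) fastforce+
  also have "\<dots> = (int (card B) + 5) * (int (card B) + 4) - (QA + QB) + (\<Sum>v\<in>K. \<Sum>u\<in>C. w u v)"
  proof -
    have "(\<Sum>v\<in>K. \<Sum>u\<in>K. q u v) = QA + QB"
      unfolding QA_def QB_def using fin disj by (subst K_def) (simp add: sum.union_disjoint)
    then show ?thesis by (simp add: sum.distrib sum_subtractf cardK)
  qed
  finally have sumK: "(\<Sum>v\<in>K. int (degree E v)) =
      (int (card B) + 5) * (int (card B) + 4) - (QA + QB) + (\<Sum>v\<in>K. \<Sum>u\<in>C. w u v)" .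
  have "(\<Sum>v\<in>C. int (degree E v)) = (\<Sum>v\<in>C. \<Sum>u\<in>K. w u v) + WC"
    by (simp add: deg sum.distrib WC_def)
  \<comment> \<open>The edges between \<open>K\<close> and \<open>C\<close> contribute equally to
    both degree sums and cancel in the sum condition.\<close>
  also have "(\<Sum>v\<in>C. \<Sum>u\<in>K. w u v) = (\<Sum>v\<in>K. \<Sum>u\<in>C. w u v)"
    by (subst sum.swap) (intro sum.cong refl w_sym)
  finally have "QA + QB + WC = 10" using sum sumK unfolding K_def by linarith
  \<comment> \<open>A vertex of \<open>A\<close> has degree two below the \<open>card B + 4\<close>
    other vertices of \<open>K\<close>, and every edge it sends to \<open>C\<close> costs one more
    non-neighbour in \<open>K\<close>.\<close>
  moreover have "QA = 10 + WA"
  proof -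
    have "(\<Sum>u\<in>K. q u v) = 2 + (\<Sum>u\<in>C. w u v)" if "v \<in> A" for v
      using row[of v] deg[of v] degA[OF that] that unfolding K_def by simp
    then have "QA = (\<Sum>v\<in>A. 2 + (\<Sum>u\<in>C. w u v))" unfolding QA_def by (intro sum.cong) auto
    then show ?thesis by (simp add: sum.distrib A5 WA_def)
  qed
  moreover have "QB \<ge> 0" "WA \<ge> 0" "WC \<ge> 0"
    unfolding QB_def WA_def WC_def by (intro sum_nonneg nonneg)+
  ultimately have "QB = 0" "WA = 0" "WC = 0" by linarith+
  then have zero: "\<And>u v. v \<in> B \<Longrightarrow> u \<in> K \<Longrightarrow> q u v = 0"
      "\<And>u v. v \<in> A \<Longrightarrow> u \<in> C \<Longrightarrow> w u v = 0" "\<And>u v. v \<in> C \<Longrightarrow> u \<in> C \<Longrightarrow> w u v = 0"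
    unfolding QB_def WA_def WC_def
    by (simp_all add: sum_nonneg_eq_0_iff sum_nonneg nonneg fin)
  have AB: "{u, v} \<in> E" if "u \<in> A" "v \<in> B" for u v
    using zero(1)[of v u] that disj by (auto simp: q_def K_def)
  have AC: "{u, v} \<notin> E" if "u \<in> A" "v \<in> C" for u v
    using zero(2)[of u v] that by (simp add: w_def insert_commute)
  \<comment> \<open>Of the \<open>card B + 2\<close> neighbours, \<open>B\<close> supplies
    \<open>card B\<close> and \<open>C\<close> none.\<close>
  have "card {u \<in> A. {u, v} \<in> E} = 2" if v: "v \<in> A" for v
  proof -
    have "{u \<in> V. {u, v} \<in> E} = {u \<in> A. {u, v} \<in> E} \<union> B"
      using V AB[OF v] AC[OF v] by (auto simp: insert_commute[of _ v])
    moreover have "card ({u \<in> A. {u, v} \<in> E} \<union> B) = card {u \<in> A. {u, v} \<in> E} + card B"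
      using fin disj by (intro card_Un_disjoint) auto
    ultimately show ?thesis using degA[OF v] degree_eq_card_neighbours[OF G, of v] by simp
  qed
  then have pent: "\<exists>a b c d e. A = {a, b, c, d, e} \<and> pentagon E a b c d e"
    by (rule pentagon_of_two_regular[OF G A5])
  show ?thesis
  proof
    fix u v assume "u \<in> B" "v \<in> B" "u \<noteq> v"
    then show "{u, v} \<in> E" using zero(1)[of v u] by (auto simp: q_def K_def)
  next
    fix u v assume "u \<in> C" "v \<in> C"
    then show "{u, v} \<notin> E" using zero(3)[of v u] by (simp add: w_def)
  qed (use G V disj pent AB AC in auto)
qed

section \<open>Positions in the degree sequence and the characterization\<close>

text \<open>Since degrees are listed in decreasing order, the positions of \<open>B\<close> and of
  \<open>A \<union> B\<close> are initial segments; their cardinalities then determine them.\<close>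

lemma down_closed_eq_atLeastAtMost:
  fixes S :: "nat set"
  assumes "S \<subseteq> {1..n}" and "\<And>i j. j \<in> S \<Longrightarrow> 1 \<le> i \<Longrightarrow> i \<le> j \<Longrightarrow> i \<in> S"
  shows "S = {1..card S}"
proof (cases "S = {}")
  case False
  have "finite S" using assms(1) finite_subset by blast
  then have "S = {1..Max S}"
    using assms Max_in[OF _ False] by (auto intro: Max_ge)
  then show ?thesis by (metis card_atLeastAtMost diff_Suc_1)
qed simp

text \<open>The conjunct \<open>m + 2 \<le> n\<close> says that the sums in (i) run over actual
  degrees, as \<open>d\<close> is arbitrary beyond \<open>n\<close>. Integers keep the subtractions
  from truncating.\<close>

theorem theorem3p9:
  fixes V :: "'a set" and E :: "'a set set" and d :: "nat \<Rightarrow> nat" and n m :: nat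
  assumes "simple_graph V E"
    and "n = card V"
    and "degree_sequence V E d"
    and "m = Max {i \<in> {1..n}. int (d i) \<ge> int i - 1}"
  shows "NG3_graph V E \<longleftrightarrow>
    m + 2 \<le> n \<and>
    (\<Sum>i = 1..m + 2. int (d i)) = (int m + 2) * (int m + 1) - 10 + (\<Sum>i = m + 3..n. int (d i)) \<and>
    (\<forall>i\<in>{1..n}. int (d i) = int m - 1 \<longleftrightarrow> int m - 2 \<le> int i \<and> int i \<le> int m + 2)"
    (is "?L \<longleftrightarrow> ?R")
proof -
  obtain v where v: "bij_betw v {1..n} V" and dv: "\<And>i. i \<in> {1..n} \<Longrightarrow> d i = degree E (v i)"
    and mono: "\<And>i j. 1 \<le> i \<Longrightarrow> i \<le> j \<Longrightarrow> j \<le> n \<Longrightarrow> d j \<le> d i"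
    using assms(2,3) unfolding degree_sequence_def by blast
  have inj: "inj_on v I" if "I \<subseteq> {1..n}" for I
    using v that by (auto simp: bij_betw_def intro: inj_on_subset)
  have sum_d: "(\<Sum>i\<in>I. int (d i)) = (\<Sum>x\<in>v ` I. int (degree E x))" if "I \<subseteq> {1..n}" for I
    using that dv by (subst sum.reindex[OF inj[OF that]]) (auto intro!: sum.cong)
  have disj: "v ` I \<inter> v ` J = {}" if "I \<subseteq> {1..n}" "J \<subseteq> {1..n}" "I \<inter> J = {}" for I J
    using inj_on_image_Int[OF inj[of "{1..n}"], of I J] that by auto
  show ?thesis
  proof
    assume ?L
    then obtain A B C where "pentagon_split V E A B C" using NG3_imp_pentagon_split[OF assms(1)] by blast
    then interpret pentagon_split V E A B C .
    define b where "b = card B"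
    have n: "n = b + 5 + card C" using card_V assms(2) b_def by simp
    have v_in: "v i \<in> A \<union> B \<union> C" if "i \<in> {1..n}" for i
      using v that V_eq by (auto simp: bij_betw_def)
    have d_cases: "v i \<in> A \<and> d i = b + 2 \<or> v i \<in> B \<and> d i \<ge> b + 4 \<or> v i \<in> C \<and> d i \<le> b"
      if "i \<in> {1..n}" for i
      using v_in[OF that] dv[OF that] degree_A[of "v i"] degree_B[of "v i"] degree_C_le[of "v i"]
      unfolding b_def by auto
    have image_v: "v ` {i \<in> {1..n}. v i \<in> X} = X" if "X \<subseteq> V" for X
      using v that by (fastforce simp: bij_betw_def)
    have card_v: "card {i \<in> {1..n}. v i \<in> X} = card X" if "X \<subseteq> V" for X
    proof -
      have "{i \<in> {1..n}. v i \<in> X} \<subseteq> {1..n}" by auto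
      from card_image[OF inj[OF this]] image_v[OF that] show ?thesis by metis
    qed
    have B_iff: "{i \<in> {1..n}. v i \<in> B} = {1..b}"
    proof -
      have "{i \<in> {1..n}. v i \<in> B} = {1..card {i \<in> {1..n}. v i \<in> B}}"
      proof (rule down_closed_eq_atLeastAtMost)
        fix i j assume ij: "j \<in> {i \<in> {1..n}. v i \<in> B}" "1 \<le> i" "i \<le> j"
        then show "i \<in> {i \<in> {1..n}. v i \<in> B}"
          using mono[of i j] d_cases[of i] d_cases[of j] disjoint by auto
      qed auto
      moreover have "card {i \<in> {1..n}. v i \<in> B} = b" using card_v V_eq b_def by blast
      ultimately show ?thesis by metis
    qed
    have AB_iff: "{i \<in> {1..n}. v i \<in> A \<union> B} = {1..b + 5}"
    proof -
      have "{i \<in> {1..n}. v i \<in> A \<union> B} = {1..card {i \<in> {1..n}. v i \<in> A \<union> B}}"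
      proof (rule down_closed_eq_atLeastAtMost)
        fix i j assume ij: "j \<in> {i \<in> {1..n}. v i \<in> A \<union> B}" "1 \<le> i" "i \<le> j"
        then show "i \<in> {i \<in> {1..n}. v i \<in> A \<union> B}"
          using mono[of i j] d_cases[of i] d_cases[of j] disjoint by auto
      qed auto
      moreover have "card {i \<in> {1..n}. v i \<in> A \<union> B} = card (A \<union> B)"
        by (rule card_v) (use V_eq in blast)
      moreover have "card (A \<union> B) = b + 5"
        using finite_parts disjoint card_A b_def by (simp add: card_Un_disjoint)
      ultimately show ?thesis by metis
    qed
    have d_eq: "d i = b + 2 \<longleftrightarrow> b + 1 \<le> i \<and> i \<le> b + 5" if "i \<in> {1..n}" for i
    proof -
      have "v i \<in> B \<longleftrightarrow> i \<le> b" "v i \<in> A \<union> B \<longleftrightarrow> i \<le> b + 5"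
        using arg_cong[OF B_iff, of "\<lambda>S. i \<in> S"] arg_cong[OF AB_iff, of "\<lambda>S. i \<in> S"] that by simp_all
      then show ?thesis using d_cases[OF that] disjoint by auto
    qed
    \<comment> \<open>The middle position of the pentagon block meets the condition with equality:
      \<open>d (b + 3) = b + 2\<close>. Later degrees are no larger, while \<open>i - 1\<close>
      is.\<close>
    have m: "m = b + 3" unfolding assms(4)
    proof (rule Max_eqI)
      fix i assume i: "i \<in> {i \<in> {1..n}. int (d i) \<ge> int i - 1}"
      show "i \<le> b + 3"
      proof (rule ccontr)
        assume "\<not> i \<le> b + 3"
        then have "d i \<le> d (b + 3)" "d (b + 3) = b + 2" using mono[of "b + 3" i] d_eq[of "b + 3"] i n by auto
        with i \<open>\<not> i \<le> b + 3\<close> show False by auto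
      qed
    qed (use d_eq[of "b + 3"] n in auto)
    have sum_low: "(\<Sum>i = 1..m + 2. int (d i)) = (\<Sum>x\<in>A \<union> B. int (degree E x))"
    proof -
      have "v ` {1..b + 5} = A \<union> B" unfolding AB_iff[symmetric] using V_eq by (intro image_v) blast
      then show ?thesis using sum_d[of "{1..b + 5}"] n m by (simp add: add.commute)
    qed
    have sum_high: "(\<Sum>i = m + 3..n. int (d i)) = (\<Sum>x\<in>C. int (degree E x))"
    proof -
      have "{b + 6..n} = {1..n} - {1..b + 5}" by auto
      also have "\<dots> = {i \<in> {1..n}. v i \<in> C}" unfolding AB_iff[symmetric] using v_in disjoint by blast
      finally have "v ` {b + 6..n} = v ` {i \<in> {1..n}. v i \<in> C}" by (rule arg_cong)
      also have "\<dots> = C" using V_eq by (intro image_v) blast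
      finally have "v ` {b + 6..n} = C" .
      then show ?thesis using sum_d[of "{b + 6..n}"] m by (simp add: add.commute)
    qed
    \<comment> \<open>Here 5(b + 2) + b(b + 4) = (b + 5)(b + 4) - 10, and the edges from
      \<open>B\<close> to \<open>C\<close> are recounted as the degree sum of
      \<open>C\<close>.\<close>
    have "(\<Sum>x\<in>A \<union> B. int (degree E x)) = (\<Sum>x\<in>A. int (degree E x)) + (\<Sum>x\<in>B. int (degree E x))"
      using finite_parts disjoint by (simp add: sum.union_disjoint)
    also have "(\<Sum>x\<in>A. int (degree E x)) = 5 * (int b + 2)"
      using degree_A card_A b_def by simp
    also have "(\<Sum>x\<in>B. int (degree E x)) = int b * (int b + 4) + int (\<Sum>x\<in>B. card {u \<in> C. {u, x} \<in> E})"
      using degree_B b_def by (simp add: sum.distrib)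
    also have "(\<Sum>x\<in>B. card {u \<in> C. {u, x} \<in> E}) = (\<Sum>x\<in>C. degree E x)"
    proof -
      have "(\<Sum>x\<in>B. card {u \<in> C. {u, x} \<in> E}) = (\<Sum>x\<in>B. \<Sum>u\<in>C. of_bool ({u, x} \<in> E))"
        using finite_parts by (simp add: sum_of_bool_eq Int_def)
      also have "\<dots> = (\<Sum>u\<in>C. \<Sum>x\<in>B. of_bool ({x, u} \<in> E))"
        by (subst sum.swap) (simp add: insert_commute)
      also have "\<dots> = (\<Sum>x\<in>C. degree E x)"
        using finite_parts degree_C by (simp add: sum_of_bool_eq Int_def)
      finally show ?thesis .
    qed
    finally have "(\<Sum>x\<in>A \<union> B. int (degree E x)) =
        (int m + 2) * (int m + 1) - 10 + (\<Sum>x\<in>C. int (degree E x))"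
      by (simp add: m algebra_simps)
    moreover have "\<forall>i\<in>{1..n}. int (d i) = int m - 1 \<longleftrightarrow> int m - 2 \<le> int i \<and> int i \<le> int m + 2"
      using d_eq m by fastforce
    ultimately show ?R using sum_low sum_high n m by simp
  next
    assume R: ?R
    then have mn: "m + 2 \<le> n"
      and sum: "(\<Sum>i = 1..m + 2. int (d i)) =
        (int m + 2) * (int m + 1) - 10 + (\<Sum>i = m + 3..n. int (d i))"
      and eq: "\<And>i. i \<in> {1..n} \<Longrightarrow>
        int (d i) = int m - 1 \<longleftrightarrow> int m - 2 \<le> int i \<and> int i \<le> int m + 2"
      by blast+
    \<comment> \<open>For smaller \<open>m\<close> the range in (ii) is cut off at 1, so the first
      \<open>m + 2\<close> degrees are all \<open>m - 1\<close> and the later ones contribute 0.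
      Then m = 0 would need a negative degree, and (i) would read 0 = -4 for m = 1 and 4 = 2 for m =
      2.\<close>
    have "m \<ge> 3"
    proof (rule ccontr)
      assume "\<not> m \<ge> 3"
      then have m: "m = 0 \<or> m = 1 \<or> m = 2" by auto
      have low: "int (d i) = int m - 1" if "i \<in> {1..m + 2}" for i
        using eq[of i] that m mn by auto
      have "int (d i) = 0" if "i \<in> {m + 3..n}" for i
        using eq[of i] low[of 1] mono[of 1 i] that m by auto
      then have "(\<Sum>i = m + 3..n. int (d i)) = 0" by simp
      moreover have "(\<Sum>i = 1..m + 2. int (d i)) = (int m + 2) * (int m - 1)"
        using low by simp
      ultimately show False using sum low[of 1] m by auto
    qed
    \<comment> \<open>Condition (ii) singles out \<open>A\<close>. Now \<open>card B\<close> is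
      \<open>m - 3\<close>, so \<open>m - 1\<close> is \<open>card B + 2\<close> and (i) becomes the
      sum condition of \<open>pentagon_split_of_degrees\<close>.\<close>
    define A B C where "A = v ` {m - 2..m + 2}" and "B = v ` {1..m - 3}" and "C = v ` {m + 3..n}"
    have AB: "A \<union> B = v ` {1..m + 2}"
      unfolding A_def B_def image_Un[symmetric] using \<open>m \<ge> 3\<close> by (intro arg_cong[of _ _ "image v"]) auto
    have "A \<union> B \<union> C = v ` {1..n}"
      unfolding AB C_def image_Un[symmetric] using mn by (intro arg_cong[of _ _ "image v"]) auto
    then have V: "V = A \<union> B \<union> C" using v by (simp add: bij_betw_def)
    have "{1..m - 3} \<subseteq> {1..n}" using mn by auto
    then have cardB: "card B = m - 3" unfolding B_def by (simp add: card_image[OF inj])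
    have "pentagon_split V E A B C"
    proof (rule pentagon_split_of_degrees[OF assms(1) V])
      show "A \<inter> B = {}" "A \<inter> C = {}" "B \<inter> C = {}"
        unfolding A_def B_def C_def using \<open>m \<ge> 3\<close> mn by (intro disj; auto)+
      show "card A = 5"
      proof -
        have "{m - 2..m + 2} \<subseteq> {1..n}" using \<open>m \<ge> 3\<close> mn by auto
        then show ?thesis unfolding A_def using \<open>m \<ge> 3\<close> by (simp add: card_image[OF inj])
      qed
      show "degree E x = card B + 2" if "x \<in> A" for x
      proof -
        obtain i where i: "x = v i" "i \<in> {m - 2..m + 2}" using \<open>x \<in> A\<close> unfolding A_def by blast
        then have "i \<in> {1..n}" using \<open>m \<ge> 3\<close> mn by auto
        then show ?thesis using eq[of i] dv[of i] i \<open>m \<ge> 3\<close> cardB by auto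
      qed
      have "int (card B) = int m - 3" using cardB \<open>m \<ge> 3\<close> by simp
      then show "(\<Sum>x\<in>A \<union> B. int (degree E x)) =
          (int (card B) + 5) * (int (card B) + 4) - 10 + (\<Sum>x\<in>C. int (degree E x))"
        using sum sum_d[of "{1..m + 2}"] sum_d[of "{m + 3..n}"] mn unfolding AB C_def
        by (simp add: add.commute)
    qed
    then show ?L by (rule pentagon_split.NG3)
  qed
qed

end
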